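(* Let $p\ge1$, $N>0$, and let $(X,d,\mathfrak m)$ be a metric measure space for which there exists $r_0>0$ such that the function $\Theta_{N,r_0}(x):=\sup_{0<r\le r_0}\frac{\mathfrak m(B_r(x))}{r^N}$ is $\mathfrak m$-integrable on bounded subsets of $X$. Then for every $u\in\mathrm{Lip}_b(X,d)$, $$\limsup_{\lambda\to+\infty}\lambda^p(\mathfrak m\times\mathfrak m)(E_{\lambda,u})\ \le\ 2\int_X\theta_N^+(x)\,(\mathrm{Lip}(u)(x))^{p}\,d\mathfrak m(x),$$ where $$E_{\lambda,u}:=\Big\{(x,y)\in X\times X:\ x\ne y,\ |u(x)-u(y)|\ge\lambda\, d(x,y)^{\frac Np+1}\Big\}.$$
   Context: A metric measure space $(X,d,\mathfrak m)$ is a non-empty complete separable metric space $(X,d)$ with a Radon measure $\mathfrak m$ such that $0<\mathfrak m(U)<+\infty$ for every non-empty bounded open set $U\subset X$. $B_r(x):=\{y\in X: d(x,y)<r\}$. For $u:X\to\mathbb R$: $\mathrm{Lip}(u)(x):=\limsup_{r\to0^+}\sup_{y\in B_r(x)}\frac{|u(y)-u(x)|}{r}$. $\mathrm{Lip}_b(X,d)$ is the set of (globally) Lipschitz functions $u:X\to\mathbb R$ with bounded support. Upper density: $\theta_N^+(x):=\limsup_{r\to0^+}\frac{\mathfrak m(B_r(x))}{r^N}\in[0,+\infty]$. Convention: $0\cdot\infty=\infty\cdot0=0$. *)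

theory Defs
  imports "HOL-Analysis.Analysis"
begin

text \<open>
  The complete separable metric space \<open>X\<close> is the whole of a type of class \<open>polish_space\<close>
  (complete and second countable metric spaces; second countability is equivalent to separability
  for metric spaces, and types are non-empty). Its balls \<open>B\<^sub>r(x)\<close> are \<open>ball x r\<close>.
\<close>

definition radon_measure :: "'a::metric_space measure \<Rightarrow> bool" where
  "radon_measure M \<longleftrightarrow>
     sets M = sets borel \<and>
     (\<forall>x. \<exists>U. open U \<and> x \<in> U \<and> emeasure M U < \<infinity>) \<and>
     (\<forall>B\<in>sets borel. emeasure M B = (SUP K\<in>{K. compact K \<and> K \<subseteq> B}. emeasure M K))"

definition metric_measure_space :: "'a::polish_space measure \<Rightarrow> bool" where
  "metric_measure_space M \<longleftrightarrow>
     radon_measure M \<and>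
     (\<forall>U. open U \<and> bounded U \<and> U \<noteq> {} \<longrightarrow> 0 < emeasure M U \<and> emeasure M U < \<infinity>)"

text \<open>
  The pointwise Lipschitz constant and the densities below may be infinite, so they are
  \<open>ennreal\<close>-valued; the product on \<open>ennreal\<close> satisfies \<open>0 * \<infinity> = \<infinity> * 0 = 0\<close>.
\<close>

definition Lip :: "('a::metric_space \<Rightarrow> real) \<Rightarrow> 'a \<Rightarrow> ennreal" where
  "Lip u x = Limsup (at_right 0) (\<lambda>r. SUP y\<in>ball x r. ennreal (\<bar>u y - u x\<bar> / r))"

definition Lip_b :: "('a::metric_space \<Rightarrow> real) set" where
  "Lip_b = {u. (\<exists>L. L-lipschitz_on UNIV u) \<and> bounded (closure {x. u x \<noteq> 0})}"

text \<open>Real powers on \<open>[0, \<infinity>]\<close>, for positive exponents.\<close>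

definition ennreal_powr :: "ennreal \<Rightarrow> real \<Rightarrow> ennreal" where
  "ennreal_powr a p = (if a = \<infinity> then \<infinity> else ennreal (enn2real a powr p))"

definition upper_density :: "'a::metric_space measure \<Rightarrow> real \<Rightarrow> 'a \<Rightarrow> ennreal" where
  "upper_density M N x =
     Limsup (at_right 0) (\<lambda>r. emeasure M (ball x r) / ennreal (r powr N))"

definition max_density :: "'a::metric_space measure \<Rightarrow> real \<Rightarrow> real \<Rightarrow> 'a \<Rightarrow> ennreal" where
  "max_density M N r0 x = (SUP r\<in>{0<..r0}. emeasure M (ball x r) / ennreal (r powr N))"

definition integrable_on_bounded_sets ::
    "'a::metric_space measure \<Rightarrow> ('a \<Rightarrow> ennreal) \<Rightarrow> bool" where
  "integrable_on_bounded_sets M f \<longleftrightarrow>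
     f \<in> borel_measurable M \<and>
     (\<forall>B\<in>sets M. bounded B \<longrightarrow> (\<integral>\<^sup>+x\<in>B. f x \<partial>M) < \<infinity>)"

definition level_set :: "real \<Rightarrow> real \<Rightarrow> real \<Rightarrow> ('a::metric_space \<Rightarrow> real) \<Rightarrow> ('a \<times> 'a) set" where
  "level_set p N l u =
     {(x, y). x \<noteq> y \<and> \<bar>u x - u y\<bar> \<ge> l * dist x y powr (N / p + 1)}"

end

theory Submission
  imports Defs
begin

text \<open>
  By Tonelli the left-hand side is \<open>\<integral> \<lambda>\<^sup>p m(E\<^sub>\<lambda>,\<^sub>x) dm(x)\<close>, where \<open>E\<^sub>\<lambda>,\<^sub>x\<close> is the fibre of \<open>E\<^sub>\<lambda>\<close> over \<open>x\<close>.
  If \<open>|u y - u x| \<le> a' d(x,y)\<close> near \<open>x\<close> and \<open>a' < a\<close>, then for large \<open>\<lambda>\<close> the fibre lies in the ball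
  around \<open>x\<close> of radius \<open>s = (a/\<lambda>)\<^sup>p\<^sup>/\<^sup>N\<close>. Since \<open>\<lambda>\<^sup>p = a\<^sup>p / s\<^sup>N\<close>, this gives
  \<open>\<lambda>\<^sup>p m(E\<^sub>\<lambda>,\<^sub>x) \<le> a\<^sup>p m(B\<^sub>s(x)) / s\<^sup>N\<close>. With \<open>a \<down> Lip(u)(x)\<close> the limsup of the fibre measures is at most
  \<open>\<theta>(x) Lip(u)(x)\<^sup>p\<close>; with \<open>a\<close> a global Lipschitz constant one gets an integrable majorant, and the
  reverse Fatou lemma concludes, even without the factor 2.
\<close>

section \<open>Reverse Fatou lemma for a real parameter\<close>

lemma Limsup_filterlim_le:
  fixes f :: "'b \<Rightarrow> 'c::complete_linorder"
  assumes "filterlim g F G"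
  shows "Limsup G (\<lambda>x. f (g x)) \<le> Limsup F f"
  unfolding Limsup_le_iff
proof (intro allI impI)
  fix y assume "Limsup F f < y"
  then have "eventually (\<lambda>x. f x < y) F" by (rule Limsup_lessD)
  then show "eventually (\<lambda>x. f (g x) < y) G"
    using assms by (rule eventually_compose_filterlim)
qed

text \<open>The reverse Fatou lemma is a statement about sequences. If the integrals reached some
  \<open>c\<close> above the claimed bound at arbitrarily large \<open>l\<close>, parameters
  \<open>s n \<ge> n\<close> could be chosen there, and this sequence would contradict it.\<close>

lemma Limsup_at_top_nn_integral_le:
  fixes f :: "real \<Rightarrow> 'a \<Rightarrow> ennreal"
  assumes f: "\<And>l. f l \<in> borel_measurable M" and w: "w \<in> borel_measurable M"
    and bound: "\<And>l x. l \<ge> l0 \<Longrightarrow> f l x \<le> w x" and fin: "(\<integral>\<^sup>+x. w x \<partial>M) < \<infinity>"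
    and lim: "AE x in M. Limsup at_top (\<lambda>l. f l x) \<le> g x"
  shows "Limsup at_top (\<lambda>l. \<integral>\<^sup>+x. f l x \<partial>M) \<le> (\<integral>\<^sup>+x. g x \<partial>M)"
  unfolding Limsup_le_iff
proof (intro allI impI, rule ccontr)
  fix c assume c: "(\<integral>\<^sup>+x. g x \<partial>M) < c"
    and "\<not> eventually (\<lambda>l. (\<integral>\<^sup>+x. f l x \<partial>M) < c) at_top"
  then have "\<forall>n::nat. \<exists>l. l \<ge> max l0 n \<and> c \<le> (\<integral>\<^sup>+x. f l x \<partial>M)"
    unfolding eventually_at_top_linorder by (meson not_le)
  then obtain s where s: "\<And>n. s n \<ge> max l0 (real n)" "\<And>n. c \<le> (\<integral>\<^sup>+x. f (s n) x \<partial>M)"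
    by metis
  have s_top: "filterlim s at_top sequentially"
    using s(1) by (intro filterlim_at_top_mono[OF filterlim_real_sequentially]) auto
  have "c \<le> limsup (\<lambda>n. \<integral>\<^sup>+x. f (s n) x \<partial>M)"
    using s(2) by (intro le_Limsup) auto
  also have "\<dots> \<le> (\<integral>\<^sup>+x. limsup (\<lambda>n. f (s n) x) \<partial>M)"
    using s(1) by (intro nn_integral_limsup[OF f w _ fin]) (auto intro!: bound)
  also have "\<dots> \<le> (\<integral>\<^sup>+x. g x \<partial>M)"
    proof (rule nn_integral_mono_AE)
    show "AE x in M. limsup (\<lambda>n. f (s n) x) \<le> g x"
      using lim by eventually_elim (rule order_trans[OF Limsup_filterlim_le[OF s_top]])
  qed
  finally show False using c by simp
qed

section \<open>Prerequisites for Tonelli on the product\<close>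

lemma sigma_finite_measure_finite_balls:
  fixes M :: "'a::metric_space measure"
  assumes "sets M = sets borel" and "\<And>x r. emeasure M (ball x r) < \<infinity>"
  shows "sigma_finite_measure M"
proof
  have "space M = UNIV" using sets_eq_imp_space_eq[OF assms(1)] by simp
  moreover have "(\<Union>n. ball x (real n)) = UNIV" for x :: 'a
    by (auto simp: reals_Archimedean2)
  ultimately show "\<exists>A. countable A \<and> A \<subseteq> sets M \<and> \<Union> A = space M \<and> (\<forall>a\<in>A. emeasure M a \<noteq> \<infinity>)"
    using assms by (intro exI[of _ "range (\<lambda>n. ball undefined (real n))"]) (auto simp: less_top)
qed

lemma measurable_level_set:
  fixes M :: "'a::polish_space measure"
  assumes "sets M = sets borel" and "continuous_on UNIV u"
  shows "level_set p N l u \<in> sets (M \<Otimes>\<^sub>M M)"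
proof -
  have [measurable]: "u \<in> borel_measurable borel"
    using assms(2) by (rule borel_measurable_continuous_onI)
  have sets: "sets (M \<Otimes>\<^sub>M M) = sets (borel \<Otimes>\<^sub>M borel)"
    by (intro sets_pair_measure_cong assms)
  \<comment> \<open>With \<open>x \<noteq> y\<close> written as a nonzero distance, only
    \<open>u\<close> and \<open>dist\<close> remain, and second countability makes
    \<open>dist\<close> measurable for the product \<sigma>-algebra.\<close>
  have "level_set p N l u = {z \<in> space (borel \<Otimes>\<^sub>M borel). dist (fst z) (snd z) \<noteq> 0 \<and>
      l * dist (fst z) (snd z) powr (N / p + 1) \<le> \<bar>u (fst z) - u (snd z)\<bar>}"
    by (auto simp: level_set_def space_pair_measure)
  also have "\<dots> \<in> sets (borel \<Otimes>\<^sub>M borel)" by measurable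
  finally show ?thesis unfolding sets .
qed

section \<open>Fibres of the level sets and balls of matching radius\<close>

lemma Pair_in_level_set_iff:
  "(x, y) \<in> level_set p N l u \<longleftrightarrow>
     x \<noteq> y \<and> l * dist x y powr (N / p + 1) \<le> \<bar>u y - u x\<bar>"
  by (auto simp: level_set_def abs_minus_commute)

text \<open>Division of \<open>l * d powr (N / p + 1) \<le> a' * d\<close> by the positive distance
  \<open>d\<close> gives \<open>d powr (N / p) \<le> a' / l < a / l\<close>. The gap between
  \<open>a'\<close> and \<open>a\<close> makes the bound strict, as open balls demand.\<close>

lemma level_set_fibre_dist_less:
  assumes "p > 0" "N > 0" "l > 0" "a' < a"
    and y: "y \<in> Pair x -` level_set p N l u" and le: "\<bar>u y - u x\<bar> \<le> a' * dist x y"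
  shows "dist x y < (a / l) powr (p / N)"
proof -
  have d: "dist x y > 0" using y by (simp add: Pair_in_level_set_iff)
  have "l * dist x y powr (N / p) * dist x y \<le> a' * dist x y"
    using y order_trans[OF _ le] by (simp add: Pair_in_level_set_iff powr_add mult.assoc del: mult_le_cancel_right)
  then have "l * dist x y powr (N / p) \<le> a'" using d by simp
  then have "dist x y powr (N / p) < a / l"
    using assms by (simp add: field_simps)
  then have "(dist x y powr (N / p)) powr (p / N) < (a / l) powr (p / N)"
    using assms by (intro powr_less_mono2) auto
  then show ?thesis using assms d by (simp add: powr_powr)
qed

lemma tendsto_radius:
  assumes "p > 0" "N > (0::real)" "a > 0"
  shows "((\<lambda>l. (a / l) powr (p / N)) \<longlongrightarrow> 0) at_top"
proof (rule tendsto_zero_powrI[OF _ tendsto_const])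
  show "((\<lambda>l. a / l) \<longlongrightarrow> 0) at_top"
    by (intro tendsto_divide_0[OF tendsto_const] filterlim_at_top_imp_at_infinity filterlim_ident)
  show "\<forall>\<^sub>F l in at_top. 0 \<le> a / l"
    using assms by (intro eventually_mono[OF eventually_gt_at_top[of 0]]) simp
qed (use assms in auto)

text \<open>As \<open>s powr N = (a / l) powr p\<close>, the growing weight turns into the density
  quotient at a radius that shrinks with \<open>l\<close>.\<close>

lemma scaled_emeasure_ball:
  assumes "p > 0" "N > 0" "a > 0" "l > 0" and "s = (a / l) powr (p / N)"
  shows "ennreal (l powr p) * emeasure M (ball x s)
    = ennreal (a powr p) * (emeasure M (ball x s) / ennreal (s powr N))"
proof -
  have "s powr N = (a / l) powr p" using assms by (simp add: powr_powr)
  then have *: "a powr p / s powr N = l powr p" using assms by (simp add: powr_divide)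
  have "s powr N > 0" using assms by simp
  then have "ennreal (l powr p) = ennreal (a powr p) / ennreal (s powr N)"
    by (subst *[symmetric], subst divide_ennreal) auto
  then show ?thesis by (simp add: ennreal_divide_times ennreal_times_divide)
qed

section \<open>Bounds from the maximal density and the pointwise Lipschitz constant\<close>

lemma upper_density_le_max_density:
  assumes "r0 > 0"
  shows "upper_density M N x \<le> max_density M N r0 x"
  unfolding upper_density_def
proof (rule Limsup_bounded)
  show "\<forall>\<^sub>F r in at_right 0. emeasure M (ball x r) / ennreal (r powr N) \<le> max_density M N r0 x"
    unfolding max_density_def using assms
    by (intro eventually_at_right_less[THEN eventually_mono] eventually_at_rightI[of 0 r0])
      (auto intro!: SUP_upper)
qed

lemma Lip_le_lipschitz:
  assumes "L-lipschitz_on UNIV u"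
  shows "Lip u x \<le> ennreal L"
  unfolding Lip_def
proof (rule Limsup_bounded)
  have L: "L \<ge> 0" using assms by (rule lipschitz_on_nonneg)
  have "\<bar>u y - u x\<bar> / r \<le> L" if "dist x y < r" for y r
  proof -
    have "\<bar>u y - u x\<bar> \<le> L * dist x y"
      using lipschitz_onD[OF assms, of y x] by (simp add: dist_real_def dist_commute)
    also have "\<dots> \<le> L * r" using that L by (simp add: mult_left_mono)
    finally show ?thesis using le_less_trans[OF zero_le_dist that] by (simp add: field_simps)
  qed
  \<comment> \<open>The estimate holds for every real \<open>r\<close>, since
    \<open>ball x r\<close> is empty when \<open>r \<le> 0\<close>.\<close>
  then show "\<forall>\<^sub>F r in at_right 0. (SUP y\<in>ball x r. ennreal (\<bar>u y - u x\<bar> / r)) \<le> ennreal L"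
    by (intro always_eventually allI SUP_least ennreal_leI) auto
qed

text \<open>\<open>Lip\<close> compares with the radius \<open>r > d(x,y)\<close>; letting \<open>r\<close> tend to \<open>d(x,y)\<close> replaces it by the distance.\<close>

lemma Lip_less_imp_local_bound:
  fixes u :: "'a::metric_space \<Rightarrow> real"
  assumes "Lip u x < ennreal a"
  obtains \<delta> where "\<delta> > 0" "\<And>y. dist x y < \<delta> \<Longrightarrow> \<bar>u y - u x\<bar> \<le> a * dist x y"
proof -
  have a: "a > 0" using assms by (metis ennreal_eq_0_iff not_less not_less_zero)
  have "\<forall>\<^sub>F r in at_right 0. (SUP y\<in>ball x r. ennreal (\<bar>u y - u x\<bar> / r)) < ennreal a"
    using assms unfolding Lip_def by (rule Limsup_lessD)
  then obtain \<delta> where \<delta>: "\<delta> > 0"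
    "\<And>r. 0 < r \<Longrightarrow> r < \<delta> \<Longrightarrow> (SUP y\<in>ball x r. ennreal (\<bar>u y - u x\<bar> / r)) < ennreal a"
    unfolding eventually_at_right_field by auto
  have "\<bar>u y - u x\<bar> / a \<le> dist x y" if y: "dist x y < \<delta>" for y
  proof (rule dense_ge_bounded[OF y])
    fix r assume r: "dist x y < r" "r < \<delta>"
    then have "r > 0" using le_less_trans[OF zero_le_dist] by blast
    have "ennreal (\<bar>u y - u x\<bar> / r) \<le> (SUP y\<in>ball x r. ennreal (\<bar>u y - u x\<bar> / r))"
      using r by (intro SUP_upper) auto
    also have "\<dots> < ennreal a" using \<delta>(2) r \<open>r > 0\<close> by blast
    finally have "\<bar>u y - u x\<bar> / r < a" using \<open>r > 0\<close> by (simp add: ennreal_less_iff)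
    then show "\<bar>u y - u x\<bar> / a \<le> r" using \<open>r > 0\<close> a by (simp add: field_simps)
  qed
  then show thesis using \<delta>(1) a by (intro that[of \<delta>]) (auto simp: field_simps)
qed

section \<open>Asymptotic and uniform bounds for the fibres\<close>

text \<open>The fibre is localised twice. The global constant confines it to a radius below
  \<open>\<delta>\<close>; there the local bound applies and improves the radius to
  \<open>(a / l) powr (p / N)\<close>, at which the density quotient is eventually below
  \<open>t\<close>.\<close>

lemma Limsup_fibre_le_of_less:
  fixes M :: "'a::metric_space measure"
  assumes "p > 0" "N > 0" and sets: "sets M = sets borel" and L: "L-lipschitz_on UNIV u"
    and t: "upper_density M N x < ennreal t" and a: "Lip u x < ennreal a"
  shows "Limsup at_top (\<lambda>l. ennreal (l powr p) * emeasure M (Pair x -` level_set p N l u))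
    \<le> ennreal (a powr p) * ennreal t"
proof (rule Limsup_bounded)
  \<comment> \<open>The intermediate \<open>a'\<close> exceeds \<open>Lip u x\<close>, which gives
    the local bound, and stays below \<open>a\<close>, which gives the inclusion in the open
    ball.\<close>
  obtain b where b: "Lip u x < b" "b < ennreal a" using dense[OF a] by auto
  then obtain a' where a': "0 \<le> a'" "a' < a" and b_eq: "b = ennreal a'"
    by (cases b) (auto simp: ennreal_less_iff)
  obtain \<delta> where \<delta>: "\<delta> > 0" "\<And>y. dist x y < \<delta> \<Longrightarrow> \<bar>u y - u x\<bar> \<le> a' * dist x y"
    using Lip_less_imp_local_bound[of u x a'] b(1) b_eq by auto
  have "\<forall>\<^sub>F r in at_right 0. emeasure M (ball x r) / ennreal (r powr N) < ennreal t"
    using t unfolding upper_density_def by (rule Limsup_lessD)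
  then obtain \<epsilon> where \<epsilon>: "\<epsilon> > 0"
    "\<And>r. 0 < r \<Longrightarrow> r < \<epsilon> \<Longrightarrow> emeasure M (ball x r) / ennreal (r powr N) < ennreal t"
    unfolding eventually_at_right_field by auto
  have L0: "L \<ge> 0" using L by (rule lipschitz_on_nonneg)
  \<comment> \<open>\<open>L + 1\<close> exceeds the Lipschitz constant strictly and is positive
    even if \<open>L = 0\<close>.\<close>
  have ev1: "\<forall>\<^sub>F l in at_top. ((L + 1) / l) powr (p / N) < \<delta>"
    using tendsto_radius[of p N "L + 1"] assms(1,2) L0 \<delta>(1) by (intro order_tendstoD) auto
  have ev2: "\<forall>\<^sub>F l in at_top. (a / l) powr (p / N) < \<epsilon>"
    using tendsto_radius[of p N a] assms(1,2) a' \<epsilon>(1) by (intro order_tendstoD) auto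
  show "\<forall>\<^sub>F l in at_top. ennreal (l powr p) * emeasure M (Pair x -` level_set p N l u)
      \<le> ennreal (a powr p) * ennreal t"
    using ev1 ev2 eventually_gt_at_top[of 0]
  proof eventually_elim
    case (elim l)
    define s where "s = (a / l) powr (p / N)"
    have s: "s > 0" "s < \<epsilon>" using elim a' by (auto simp: s_def)
    have "Pair x -` level_set p N l u \<subseteq> ball x s"
    proof
      fix y assume y: "y \<in> Pair x -` level_set p N l u"
      have "\<bar>u y - u x\<bar> \<le> L * dist x y"
        using lipschitz_onD[OF L, of y x] by (simp add: dist_real_def dist_commute)
      then have "dist x y < ((L + 1) / l) powr (p / N)"
        using y elim assms(1,2) by (intro level_set_fibre_dist_less[of p N l L]) auto
      then have "\<bar>u y - u x\<bar> \<le> a' * dist x y" using elim \<delta>(2) by auto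
      then show "y \<in> ball x s"
        using y elim assms(1,2) a' unfolding s_def
        by (auto intro!: level_set_fibre_dist_less[of p N l a'])
    qed
    then have "ennreal (l powr p) * emeasure M (Pair x -` level_set p N l u)
        \<le> ennreal (l powr p) * emeasure M (ball x s)"
      using sets by (intro mult_left_mono emeasure_mono) auto
    also have "\<dots> = ennreal (a powr p) * (emeasure M (ball x s) / ennreal (s powr N))"
      using assms(1,2) a' elim by (intro scaled_emeasure_ball) (auto simp: s_def)
    also have "\<dots> \<le> ennreal (a powr p) * ennreal t"
      using \<epsilon>(2)[OF s] by (intro mult_left_mono) auto
    finally show ?case .
  qed
qed

text \<open>The strict version is taken at \<open>T + e\<close> and \<open>A + e\<close>, and
  \<open>e\<close> decreases to 0. Finiteness of the density keeps the product away from
  \<open>\<infinity> * 0\<close>, where this passage to the limit would fail.\<close>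

lemma Limsup_fibre_le:
  fixes M :: "'a::metric_space measure"
  assumes "p > 0" "N > 0" and sets: "sets M = sets borel" and L: "L-lipschitz_on UNIV u"
    and fin: "upper_density M N x < \<infinity>"
  shows "Limsup at_top (\<lambda>l. ennreal (l powr p) * emeasure M (Pair x -` level_set p N l u))
    \<le> upper_density M N x * ennreal_powr (Lip u x) p"
proof -
  obtain T where T: "T \<ge> 0" "upper_density M N x = ennreal T"
    using fin by (metis ennreal_cases infinity_ennreal_def less_irrefl)
  have "Lip u x < \<infinity>" using Lip_le_lipschitz[OF L] by (metis ennreal_less_top infinity_ennreal_def le_less_trans)
  then obtain A where A: "A \<ge> 0" "Lip u x = ennreal A"
    by (metis ennreal_cases infinity_ennreal_def less_irrefl)
  \<comment> \<open>For \<open>A = 0\<close> the power still converges at base 0, because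
    \<open>p > 0\<close> and \<open>A + e\<close> is nonnegative.\<close>
  have lim: "((\<lambda>e. ennreal ((A + e) powr p * (T + e))) \<longlongrightarrow> ennreal ((A + 0) powr p * (T + 0))) (at_right 0)"
    using assms(1) A(1)
    by (intro tendsto_ennrealI tendsto_mult tendsto_powr' tendsto_add tendsto_const tendsto_ident_at)
      (auto simp: eventually_at_right_field intro!: exI[of _ 1])
  have "Limsup at_top (\<lambda>l. ennreal (l powr p) * emeasure M (Pair x -` level_set p N l u))
    \<le> ennreal ((A + 0) powr p * (T + 0))"
  proof (rule tendsto_lowerbound[OF lim])
    show "\<forall>\<^sub>F e in at_right 0. Limsup at_top (\<lambda>l. ennreal (l powr p) * emeasure M (Pair x -` level_set p N l u))
        \<le> ennreal ((A + e) powr p * (T + e))"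
      using eventually_at_right_less[of "0::real"]
    proof eventually_elim
      case (elim e)
      then show ?case
        using Limsup_fibre_le_of_less[OF assms(1-4), of x "T + e" "A + e"] A T
        by (simp add: ennreal_less_iff ennreal_mult)
    qed
  qed simp
  also have "\<dots> = upper_density M N x * ennreal_powr (Lip u x) p"
    using A T by (simp add: ennreal_powr_def ennreal_mult mult.commute)
  finally show ?thesis .
qed

text \<open>The global constant replaces the local ones, so the bound is uniform in \<open>l\<close>
  once the radius is at most \<open>r0\<close> and can serve as a majorant.\<close>

lemma fibre_le_max_density:
  fixes M :: "'a::metric_space measure"
  assumes "p > 0" "N > 0" "l > 0" and sets: "sets M = sets borel" and L: "L-lipschitz_on UNIV u"
    and r0: "((L + 1) / l) powr (p / N) \<le> r0"
  shows "ennreal (l powr p) * emeasure M (Pair x -` level_set p N l u)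
    \<le> ennreal ((L + 1) powr p) * max_density M N r0 x"
proof -
  define s where "s = ((L + 1) / l) powr (p / N)"
  have L0: "L \<ge> 0" using L by (rule lipschitz_on_nonneg)
  have "Pair x -` level_set p N l u \<subseteq> ball x s"
  proof
    fix y assume y: "y \<in> Pair x -` level_set p N l u"
    have "\<bar>u y - u x\<bar> \<le> L * dist x y"
      using lipschitz_onD[OF L, of y x] by (simp add: dist_real_def dist_commute)
    then show "y \<in> ball x s"
      using y assms(1-3) unfolding s_def by (auto intro!: level_set_fibre_dist_less[of p N l L])
  qed
  then have "ennreal (l powr p) * emeasure M (Pair x -` level_set p N l u)
      \<le> ennreal (l powr p) * emeasure M (ball x s)"
    using sets by (intro mult_left_mono emeasure_mono) auto
  also have "\<dots> = ennreal ((L + 1) powr p) * (emeasure M (ball x s) / ennreal (s powr N))"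
    using assms(1-3) L0 by (intro scaled_emeasure_ball) (auto simp: s_def)
  also have "\<dots> \<le> ennreal ((L + 1) powr p) * max_density M N r0 x"
    unfolding max_density_def using r0 L0 assms(3)
    by (intro mult_left_mono SUP_upper) (auto simp: s_def)
  finally show ?thesis .
qed

text \<open>Since \<open>u x = 0\<close>, a point \<open>y\<close> of the fibre has
  \<open>u y \<noteq> 0\<close> and lies within \<open>R\<close> of \<open>x0\<close>, yet at
  distance less than 1 from \<open>x\<close>. This confines the majorant to a bounded set.\<close>

lemma level_set_fibre_empty:
  fixes x0 :: "'a::metric_space"
  assumes "p > 0" "N > 0" "l > 0" and L: "L-lipschitz_on UNIV u"
    and supp: "\<And>y. u y \<noteq> 0 \<Longrightarrow> dist x0 y \<le> R"
    and small: "((L + 1) / l) powr (p / N) \<le> 1" and x: "x \<notin> ball x0 (R + 1)"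
  shows "Pair x -` level_set p N l u = {}"
proof (rule equals0I)
  fix y assume y: "y \<in> Pair x -` level_set p N l u"
  have ux: "u x = 0" using supp[of x] x by auto
  have "0 < l * dist x y powr (N / p + 1)" using y assms(3) by (simp add: Pair_in_level_set_iff)
  then have "u y \<noteq> 0" using y ux by (auto simp: Pair_in_level_set_iff)
  then have "dist x0 y \<le> R" by (rule supp)
  moreover have "\<bar>u y - u x\<bar> \<le> L * dist x y"
    using lipschitz_onD[OF L, of y x] by (simp add: dist_real_def dist_commute)
  then have "dist x y < 1"
    using level_set_fibre_dist_less[of p N l L "L + 1" y x u] y assms(1-3) small by auto
  ultimately show False
    using x dist_triangle[of x0 x y] by (simp add: dist_commute)
qed

section \<open>Dominated passage to the limit in the Tonelli integral\<close>

theorem theorem3p2: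
  fixes M :: "'a::polish_space measure" and p N :: real and u :: "'a \<Rightarrow> real"
  assumes "p \<ge> 1" and "N > 0"
    and "metric_measure_space M"
    and "\<exists>r0>0. integrable_on_bounded_sets M (max_density M N r0)"
    and "u \<in> Lip_b"
  shows "Limsup at_top
           (\<lambda>l::real. ennreal (l powr p) * emeasure (M \<Otimes>\<^sub>M M) (level_set p N l u))
         \<le> 2 * (\<integral>\<^sup>+x. upper_density M N x * ennreal_powr (Lip u x) p \<partial>M)"
proof -
  have p: "p > 0" using assms(1) by simp
  have sets: "sets M = sets borel"
    using assms(3) by (simp add: metric_measure_space_def radon_measure_def)
  have "emeasure M (ball x r) < \<infinity>" for x r
    using assms(3) by (cases "ball x r = {}") (simp_all add: metric_measure_space_def del: ball_eq_empty)
  then interpret sigma_finite_measure M by (intro sigma_finite_measure_finite_balls sets)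
  obtain L where L: "L-lipschitz_on UNIV u" using assms(5) by (auto simp: Lip_b_def)
  have L0: "L \<ge> 0" using L by (rule lipschitz_on_nonneg)
  define x0 :: 'a where "x0 = undefined"
  have "bounded {x. u x \<noteq> 0}"
    using assms(5) bounded_subset[OF _ closure_subset] by (auto simp: Lip_b_def)
  then obtain R where R: "\<And>y. u y \<noteq> 0 \<Longrightarrow> dist x0 y \<le> R"
    by (auto simp: bounded_any_center[of _ x0])
  obtain r0 where r0: "r0 > 0" "integrable_on_bounded_sets M (max_density M N r0)"
    using assms(4) by auto
  define f where "f = (\<lambda>l x. ennreal (l powr p) * emeasure M (Pair x -` level_set p N l u))"
  define w where
    "w = (\<lambda>x. ennreal ((L + 1) powr p) * (max_density M N r0 x * indicator (ball x0 (R + 1)) x))"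
  have E: "level_set p N l u \<in> sets (M \<Otimes>\<^sub>M M)" for l
    using sets L by (intro measurable_level_set lipschitz_on_continuous_on)
  have B: "ball x0 (R + 1) \<in> sets M" using sets by simp
  have \<Theta>: "max_density M N r0 \<in> borel_measurable M"
    using r0(2) by (simp add: integrable_on_bounded_sets_def)
  have f_meas: "f l \<in> borel_measurable M" for l
    unfolding f_def by (intro borel_measurable_times_ennreal measurable_emeasure_Pair E) simp
  have w_meas: "w \<in> borel_measurable M"
    unfolding w_def using \<Theta> B by measurable
  have "(\<integral>\<^sup>+x\<in>ball x0 (R + 1). max_density M N r0 x \<partial>M) < \<infinity>"
    using r0(2) B unfolding integrable_on_bounded_sets_def by auto
  then have w_fin: "(\<integral>\<^sup>+x. w x \<partial>M) < \<infinity>"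
    unfolding w_def using \<Theta> B
    by (subst nn_integral_cmult) (auto simp: ennreal_mult_less_top)
  \<comment> \<open>A radius at most \<open>r0\<close> allows comparison with
    \<open>max_density\<close>; a radius at most 1 makes the fibres over points outside
    \<open>ball x0 (R + 1)\<close> empty.\<close>
  have small: "\<forall>\<^sub>F l in at_top. ((L + 1) / l) powr (p / N) < min r0 1"
    using tendsto_radius[of p N "L + 1"] p assms(2) L0 r0(1) by (intro order_tendstoD) auto
  obtain l0 where l0: "\<And>l. l \<ge> l0 \<Longrightarrow> l > 0"
    "\<And>l. l \<ge> l0 \<Longrightarrow> ((L + 1) / l) powr (p / N) < min r0 1"
    using eventually_conj[OF eventually_gt_at_top[of 0] small]
    by (auto simp: eventually_at_top_linorder)
  have f_zero: "f l x = 0" if "l \<ge> l0" "x \<notin> ball x0 (R + 1)" for l x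
    using level_set_fibre_empty[OF p assms(2) l0(1)[OF that(1)] L R _ that(2)] l0(2)[OF that(1)]
    by (simp add: f_def)
  have bound: "f l x \<le> w x" if "l \<ge> l0" for l x
    using fibre_le_max_density[OF p assms(2) l0(1)[OF that] sets L, of r0 x] l0(2)[OF that] f_zero[OF that, of x]
    by (cases "x \<in> ball x0 (R + 1)") (auto simp: f_def w_def)
  \<comment> \<open>The finite integral of \<open>w\<close> makes \<open>w\<close> finite almost
    everywhere. On the ball its factor \<open>(L + 1) powr p\<close> is positive, so the density is
    finite there; off the ball \<open>f l x\<close> vanishes for \<open>l \<ge> l0\<close>.\<close>
  have lim: "AE x in M. Limsup at_top (\<lambda>l. f l x) \<le> upper_density M N x * ennreal_powr (Lip u x) p"
    using nn_integral_PInf_AE[OF w_meas less_imp_neq[OF w_fin]]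
  proof eventually_elim
    case (elim x)
    show ?case
    proof (cases "x \<in> ball x0 (R + 1)")
      case True
      then have "max_density M N r0 x < \<infinity>"
        using elim L0 by (auto simp: w_def ennreal_mult_eq_top_iff less_top)
      then have "upper_density M N x < \<infinity>"
        using upper_density_le_max_density[OF r0(1)] le_less_trans by blast
      then show ?thesis
        unfolding f_def by (intro Limsup_fibre_le[OF p assms(2) sets L])
    next
      case False
      have "Limsup at_top (\<lambda>l. f l x) \<le> 0"
        using f_zero[OF _ False] by (intro Limsup_bounded) (auto simp: eventually_at_top_linorder)
      then show ?thesis by simp
    qed
  qed
  have "Limsup at_top (\<lambda>l. ennreal (l powr p) * emeasure (M \<Otimes>\<^sub>M M) (level_set p N l u))
      = Limsup at_top (\<lambda>l. \<integral>\<^sup>+x. f l x \<partial>M)"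
    unfolding f_def
    by (simp add: emeasure_pair_measure_alt[OF E] nn_integral_cmult measurable_emeasure_Pair[OF E])
  also have "\<dots> \<le> (\<integral>\<^sup>+x. upper_density M N x * ennreal_powr (Lip u x) p \<partial>M)"
    by (rule Limsup_at_top_nn_integral_le[OF f_meas w_meas bound w_fin lim])
  also have "\<dots> \<le> 2 * (\<integral>\<^sup>+x. upper_density M N x * ennreal_powr (Lip u x) p \<partial>M)"
    by (simp add: mult_2)
  finally show ?thesis .
qed

end
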